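(* Let $G$ be a finitely generated abelian-by-finite group, and let $A\le G$ be a free abelian normal subgroup of finite index. If $G^{ab}=G/G'$ is finite, then $$\exp(G^{ab})\le \exp_{\bullet}(G)\le |G/A|.$$
   Context: For elements $x,y$ of a group, $x^y$ denotes $y^{-1}xy$. An element $g$ of a group $G$ is generalized torsion if there exist an integer $k\ge 1$ and $x_1,\dots,x_k\in G$ with $g^{x_1}\cdots g^{x_k}=1$; the set of all such elements is $\mathsf{T}_{\bullet}(G)$. For a conjugacy class $C$ of $G$ and $k\geq 1$, put $C^k=\{c_1\cdots c_k\mid c_i\in C\}$. The generalized exponent $\exp_{\bullet}(G)$ is the smallest positive integer $k$ such that $1\in C^k$ for all conjugacy classes $C$ of $G$, if such a $k$ exists (in which case $\mathsf{T}_{\bullet}(G)=G$); the inequalities in the claim include the assertion that it exists. $\exp(H)$ denotes the usual exponent of a group $H$. A group is abelian-by-finite if it has an abelian normal subgroup of finite index. *)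

theory Defs
  imports "HOL-Algebra.Algebra" "HOL-Algebra.Free_Abelian_Groups"
begin

definition finitely_generated :: "('a, 'b) monoid_scheme \<Rightarrow> bool" where
  "finitely_generated G \<longleftrightarrow> (\<exists>S. finite S \<and> S \<subseteq> carrier G \<and> generate G S = carrier G)"

text \<open>The basis \<open>S\<close> is taken in the element type of the group. This is no restriction:
  every basis of a free abelian group is a subset of the group itself.
  The trivial group is free abelian, on \<open>S = {}\<close>.\<close>

definition free_abelian :: "('a, 'b) monoid_scheme \<Rightarrow> bool" where
  "free_abelian G \<longleftrightarrow> group G \<and> (\<exists>S :: 'a set. G \<cong> free_Abelian_group S)"

definition abelian_by_finite :: "('a, 'b) monoid_scheme \<Rightarrow> bool" where
  "abelian_by_finite G \<longleftrightarrow>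
     (\<exists>N. N \<lhd> G \<and> comm_group (G\<lparr>carrier := N\<rparr>) \<and> finite (carrier (G Mod N)))"

definition abelianization :: "('a, 'b) monoid_scheme \<Rightarrow> 'a set monoid" where
  "abelianization G = G Mod derived G (carrier G)"

text \<open>The value 0 stands for ``no positive exponent exists''.\<close>

definition group_exponent :: "('a, 'b) monoid_scheme \<Rightarrow> nat" where
  "group_exponent G =
     (if \<exists>k>0. \<forall>x\<in>carrier G. x [^]\<^bsub>G\<^esub> (k::nat) = \<one>\<^bsub>G\<^esub>
      then LEAST k. k > 0 \<and> (\<forall>x\<in>carrier G. x [^]\<^bsub>G\<^esub> k = \<one>\<^bsub>G\<^esub>) else 0)"

definition conj_class :: "('a, 'b) monoid_scheme \<Rightarrow> 'a \<Rightarrow> 'a set" where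
  "conj_class G x = {inv\<^bsub>G\<^esub> y \<otimes>\<^bsub>G\<^esub> x \<otimes>\<^bsub>G\<^esub> y | y. y \<in> carrier G}"

definition conj_classes :: "('a, 'b) monoid_scheme \<Rightarrow> 'a set set" where
  "conj_classes G = conj_class G ` carrier G"

text \<open>\<open>C\<^sup>k = {c\<^sub>1 \<cdots> c\<^sub>k | c\<^sub>i \<in> C}\<close>; the \<open>c\<^sub>i\<close> need not be distinct.\<close>

definition class_power :: "('a, 'b) monoid_scheme \<Rightarrow> 'a set \<Rightarrow> nat \<Rightarrow> 'a set" where
  "class_power G C k =
     {foldr (\<lambda>x y. x \<otimes>\<^bsub>G\<^esub> y) cs \<one>\<^bsub>G\<^esub> | cs. length cs = k \<and> set cs \<subseteq> C}"

definition has_gen_exponent :: "('a, 'b) monoid_scheme \<Rightarrow> bool" where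
  "has_gen_exponent G \<longleftrightarrow> (\<exists>k>0. \<forall>C\<in>conj_classes G. \<one>\<^bsub>G\<^esub> \<in> class_power G C k)"

text \<open>As above, 0 if no such \<open>k\<close> exists; upper bounds are therefore only meaningful together with
  \<^const>\<open>has_gen_exponent\<close>.\<close>

definition gen_exponent :: "('a, 'b) monoid_scheme \<Rightarrow> nat" where
  "gen_exponent G =
     (if has_gen_exponent G
      then LEAST k. k > 0 \<and> (\<forall>C\<in>conj_classes G. \<one>\<^bsub>G\<^esub> \<in> class_power G C k) else 0)"

end

theory Submission
  imports Defs
begin

text \<open>Since \<open>A\<close> is torsion-free abelian and \<open>G/G'\<close> is finite, the transfer homomorphism
  \<open>V : G \<rightarrow> A\<close> is trivial. For a section \<open>r\<close> of the right cosets of \<open>A\<close>, the element \<open>V(g)\<close> is the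
  product of the factors \<open>r(c) g r(c g)\<inverse>\<close> over all cosets \<open>c\<close>. Multiplied along a cycle of length
  \<open>m\<close> of the permutation \<open>c \<mapsto> c g\<close>, these telescope to \<open>r(c) g\<^sup>m r(c)\<inverse>\<close>, so \<open>V(g) = 1\<close> exhibits
  \<open>1\<close> as a product of \<open>|G/A|\<close> conjugates of \<open>g\<close>. Conversely, a product of \<open>k\<close> conjugates of \<open>g\<close>
  maps to the \<open>k\<close>-th power of the image of \<open>g\<close> in \<open>G/G'\<close>.\<close>

context group
begin

section \<open>Products of conjugates of a fixed element\<close>

lemma inv_mult_cancel:
  assumes "x \<in> carrier G" "y \<in> carrier G"
  shows "inv x \<otimes> (x \<otimes> y) = y"
  using assms by (simp add: m_assoc[symmetric])

lemma conj_class_subset_carrier: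
  assumes "x \<in> carrier G"
  shows "conj_class G x \<subseteq> carrier G"
  using assms by (auto simp: conj_class_def)

lemma foldr_mult_closed:
  assumes "set cs \<subseteq> carrier G"
  shows "foldr (\<lambda>x y. x \<otimes> y) cs \<one> \<in> carrier G"
  using assms by (induction cs) auto

lemma foldr_mult_append:
  assumes "set cs \<subseteq> carrier G" "set ds \<subseteq> carrier G"
  shows "foldr (\<lambda>x y. x \<otimes> y) (cs @ ds) \<one> =
    foldr (\<lambda>x y. x \<otimes> y) cs \<one> \<otimes> foldr (\<lambda>x y. x \<otimes> y) ds \<one>"
  using assms by (induction cs) (auto simp: foldr_mult_closed m_assoc simp del: foldr_append)

lemma one_in_class_power_0: "\<one> \<in> class_power G C 0"
  by (auto simp: class_power_def)

lemma class_power_1: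
  assumes "c \<in> C" "c \<in> carrier G"
  shows "c \<in> class_power G C 1"
  unfolding class_power_def using assms by (auto intro!: exI[of _ "[c]"])

lemma class_power_mult:
  assumes "C \<subseteq> carrier G" "a \<in> class_power G C m" "b \<in> class_power G C n"
  shows "a \<otimes> b \<in> class_power G C (m + n)"
proof -
  obtain cs ds where cs: "length cs = m" "set cs \<subseteq> C" "a = foldr (\<lambda>x y. x \<otimes> y) cs \<one>"
    and ds: "length ds = n" "set ds \<subseteq> C" "b = foldr (\<lambda>x y. x \<otimes> y) ds \<one>"
    using assms(2,3) by (auto simp: class_power_def)
  have "a \<otimes> b = foldr (\<lambda>x y. x \<otimes> y) (cs @ ds) \<one>"
    unfolding cs(3) ds(3) using assms(1) cs(2) ds(2) by (intro foldr_mult_append[symmetric]) auto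
  moreover have "length (cs @ ds) = m + n" "set (cs @ ds) \<subseteq> C"
    using cs ds by auto
  ultimately show ?thesis
    unfolding class_power_def by blast
qed

text \<open>Conjugation commutes with powers, so the element is the \<open>n\<close>-th power of the
  single conjugate of \<open>g\<close> by \<open>inv x\<close>. This is the telescoped value
  contributed by one closed cycle.\<close>

lemma conj_pow_in_class_power:
  assumes g: "g \<in> carrier G" and x: "x \<in> carrier G"
  shows "x \<otimes> g [^] (n::nat) \<otimes> inv x \<in> class_power G (conj_class G g) n"
proof (induction n)
  case 0
  then show ?case using x by (simp add: one_in_class_power_0)
next
  case (Suc n)
  have "x \<otimes> g \<otimes> inv x \<in> conj_class G g"
    unfolding conj_class_def using x by (auto intro!: exI[of _ "inv x"])
  then have "x \<otimes> g \<otimes> inv x \<in> class_power G (conj_class G g) 1"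
    using g x by (intro class_power_1) auto
  then have "x \<otimes> g [^] n \<otimes> inv x \<otimes> (x \<otimes> g \<otimes> inv x) \<in> class_power G (conj_class G g) (n + 1)"
    using Suc conj_class_subset_carrier[OF g] by (intro class_power_mult)
  moreover have "x \<otimes> g [^] n \<otimes> inv x \<otimes> (x \<otimes> g \<otimes> inv x) = x \<otimes> g [^] Suc n \<otimes> inv x"
    using g x by (simp add: m_assoc inv_mult_cancel)
  ultimately show ?case by simp
qed

text \<open>The exponents \<open>m\<close> make the induction on \<open>|S|\<close> go through: a point \<open>\<sigma> t \<noteq> t\<close> is cut out of its
  cycle by merging its factor into that of \<open>t\<close>.\<close>

lemma finprod_permutation_in_class_power:
  fixes m :: "'i \<Rightarrow> nat"
  assumes "subgroup A G" "comm_group (G\<lparr>carrier := A\<rparr>)"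
    and g: "g \<in> carrier G"
    and "finite S" "bij_betw \<sigma> S S" "r \<in> S \<rightarrow> carrier G"
    and "\<And>c. c \<in> S \<Longrightarrow> r c \<otimes> g [^] m c \<otimes> inv (r (\<sigma> c)) \<in> A"
  shows "finprod (G\<lparr>carrier := A\<rparr>) (\<lambda>c. r c \<otimes> g [^] m c \<otimes> inv (r (\<sigma> c))) S
    \<in> class_power G (conj_class G g) (\<Sum>c\<in>S. m c)"
proof -
  interpret AG: comm_group "G\<lparr>carrier := A\<rparr>" by fact
  \<comment> \<open>The section \<open>r\<close> and the element \<open>g\<close> stay fixed; the
    permutation and the exponents must vary, since removing a point changes both.\<close>
  show ?thesis using assms(4-)
  proof (induction "card S" arbitrary: S \<sigma> m)
    case 0
    then show ?case by (simp add: one_in_class_power_0)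
  next
    case (Suc k)
    note fin = \<open>finite S\<close> and bij = \<open>bij_betw \<sigma> S S\<close> and r = \<open>r \<in> S \<rightarrow> carrier G\<close>
      and inA = Suc.prems(4)
    have inj: "inj_on \<sigma> S" and img: "\<sigma> ` S = S" using bij by (auto simp: bij_betw_def)
    let ?f = "\<lambda>\<sigma> m c. r c \<otimes> g [^] (m c :: nat) \<otimes> inv (r (\<sigma> c))"
    let ?C = "conj_class G g"
    obtain t where t: "t \<in> S" using Suc.hyps(2) by fastforce
    define u where "u = \<sigma> t"
    have u: "u \<in> S" using t img by (auto simp: u_def)
    show ?case
    proof (cases "u = t")
      case True
      \<comment> \<open>A fixed point is a cycle already collapsed: its factor is \<open>r t\<close>
        times a power of \<open>g\<close> times \<open>inv (r t)\<close>, so it splits off as a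
        product of \<open>m t\<close> conjugates.\<close>
      let ?S = "S - {t}"
      have "\<sigma> ` ?S = S - {\<sigma> t}"
        using inj img t by (simp add: inj_on_image_set_diff[of \<sigma> S])
      then have "bij_betw \<sigma> ?S ?S"
        using inj True by (auto simp: bij_betw_def u_def intro: inj_on_subset)
      then have IH: "finprod (G\<lparr>carrier := A\<rparr>) (?f \<sigma> m) ?S \<in> class_power G ?C (\<Sum>c\<in>?S. m c)"
        using Suc.hyps t fin r inA by (intro Suc.hyps(1)) auto
      have "?f \<sigma> m t \<in> class_power G ?C (m t)"
        using conj_pow_in_class_power[OF g, of "r t" "m t"] r t True by (auto simp: u_def)
      then have "?f \<sigma> m t \<otimes> finprod (G\<lparr>carrier := A\<rparr>) (?f \<sigma> m) ?S
          \<in> class_power G ?C (m t + (\<Sum>c\<in>?S. m c))"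
        using IH conj_class_subset_carrier[OF g] by (intro class_power_mult)
      moreover have "finprod (G\<lparr>carrier := A\<rparr>) (?f \<sigma> m) (insert t ?S) =
          ?f \<sigma> m t \<otimes> finprod (G\<lparr>carrier := A\<rparr>) (?f \<sigma> m) ?S"
        using AG.finprod_insert[of ?S t "?f \<sigma> m"] inA t fin by auto
      moreover have "(\<Sum>c\<in>S. m c) = m t + (\<Sum>c\<in>?S. m c)"
        using fin t by (simp add: sum.remove)
      ultimately show ?thesis using t by (simp add: insert_absorb)
    next
      case False
      let ?S = "S - {u}"
      let ?R = "S - {u} - {t}"
      \<comment> \<open>Bypass \<open>u\<close>: send \<open>t\<close> directly to
        \<open>\<sigma> u\<close> and let its exponent absorb that of \<open>u\<close>.\<close>
      define \<sigma>' where "\<sigma>' = \<sigma>(t := \<sigma> u)"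
      define m' where "m' = m(t := m t + m u)"
      have S_eq: "S = insert u (insert t ?R)" "?S = insert t ?R" using t u False by auto
      have "\<sigma>' ` ?R = \<sigma> ` (S - {u, t})" by (auto simp: \<sigma>'_def)
      also have "\<dots> = S - {\<sigma> u, u}"
        using inj img t u by (simp add: inj_on_image_set_diff[of \<sigma> S] u_def)
      finally have "\<sigma>' ` insert t ?R = insert (\<sigma> u) (S - {\<sigma> u, u})"
        by (simp only: image_insert) (simp add: \<sigma>'_def)
      then have "\<sigma>' ` ?S = insert (\<sigma> u) (S - {\<sigma> u, u})"
        by (simp only: S_eq(2)[symmetric])
      \<comment> \<open>Injectivity with \<open>\<sigma> t = u\<close> and
        \<open>t \<noteq> u\<close> keeps the new target of \<open>t\<close> inside
        \<open>?S\<close>.\<close>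
      moreover have "\<sigma> u \<noteq> u" "\<sigma> u \<in> S"
        using False inj t u img unfolding u_def inj_on_def by auto
      ultimately have img': "\<sigma>' ` ?S = ?S" by auto
      then have bij': "bij_betw \<sigma>' ?S ?S"
        using fin by (auto simp: bij_betw_def intro: eq_card_imp_inj_on)
      have rc: "r t \<in> carrier G" "r u \<in> carrier G" "r (\<sigma> u) \<in> carrier G"
        using r t u \<open>\<sigma> u \<in> S\<close> by auto
      \<comment> \<open>The merged factor telescopes: \<open>inv (r u)\<close> at the end of the
        factor of \<open>t\<close> cancels \<open>r u\<close> at the start of the factor of
        \<open>u\<close>.\<close>
      have "?f \<sigma>' m' t = r t \<otimes> (g [^] m t \<otimes> g [^] m u) \<otimes> inv (r (\<sigma> u))"
        using g by (simp add: \<sigma>'_def m'_def nat_pow_mult)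
      also have "\<dots> = ?f \<sigma> m t \<otimes> ?f \<sigma> m u"
        using rc g by (simp add: m_assoc inv_mult_cancel flip: u_def)
      \<comment> \<open>Commutativity in \<open>A\<close> swaps the two factors into the order in
        which \<open>finprod_insert\<close> will produce them.\<close>
      finally have ft: "?f \<sigma>' m' t = ?f \<sigma> m u \<otimes> ?f \<sigma> m t"
        using AG.m_comm inA t u by auto
      have fR: "?f \<sigma>' m' c = ?f \<sigma> m c" if "c \<in> ?R" for c
        using that by (auto simp: \<sigma>'_def m'_def)
      have inA': "?f \<sigma>' m' c \<in> A" if "c \<in> ?S" for c
      proof (cases "c = t")
        case True
        then show ?thesis using ft inA t u subgroup.m_closed[OF assms(1)] by auto
      next
        case False
        then show ?thesis using that fR[of c] inA[of c] by auto
      qed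
      have IH: "finprod (G\<lparr>carrier := A\<rparr>) (?f \<sigma>' m') ?S \<in> class_power G ?C (\<Sum>c\<in>?S. m' c)"
        using Suc.hyps u fin r inA' bij' by (intro Suc.hyps(1)) auto
      have "finprod (G\<lparr>carrier := A\<rparr>) (?f \<sigma> m) S =
          ?f \<sigma> m u \<otimes> (?f \<sigma> m t \<otimes> finprod (G\<lparr>carrier := A\<rparr>) (?f \<sigma> m) ?R)"
      proof -
        have "finprod (G\<lparr>carrier := A\<rparr>) (?f \<sigma> m) (insert u (insert t ?R)) =
            ?f \<sigma> m u \<otimes> finprod (G\<lparr>carrier := A\<rparr>) (?f \<sigma> m) (insert t ?R)"
          using AG.finprod_insert[of "insert t ?R" u "?f \<sigma> m"] inA t u fin False by auto
        moreover have "finprod (G\<lparr>carrier := A\<rparr>) (?f \<sigma> m) (insert t ?R) =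
            ?f \<sigma> m t \<otimes> finprod (G\<lparr>carrier := A\<rparr>) (?f \<sigma> m) ?R"
          using AG.finprod_insert[of ?R t "?f \<sigma> m"] inA t fin by auto
        ultimately show ?thesis using S_eq(1) by simp
      qed
      also have "\<dots> = ?f \<sigma>' m' t \<otimes> finprod (G\<lparr>carrier := A\<rparr>) (?f \<sigma> m) ?R"
        using AG.m_assoc[of "?f \<sigma> m u" "?f \<sigma> m t" "finprod (G\<lparr>carrier := A\<rparr>) (?f \<sigma> m) ?R"]
          AG.finprod_closed[of "?f \<sigma> m" ?R] inA t u ft by auto
      also have "finprod (G\<lparr>carrier := A\<rparr>) (?f \<sigma> m) ?R = finprod (G\<lparr>carrier := A\<rparr>) (?f \<sigma>' m') ?R"
        using fR inA' by (intro AG.finprod_cong') auto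
      also have "?f \<sigma>' m' t \<otimes> \<dots> = finprod (G\<lparr>carrier := A\<rparr>) (?f \<sigma>' m') (insert t ?R)"
        using AG.finprod_insert[of ?R t "?f \<sigma>' m'"] inA' t fin False by auto
      also have "\<dots> = finprod (G\<lparr>carrier := A\<rparr>) (?f \<sigma>' m') ?S" using S_eq(2) by simp
      finally have "finprod (G\<lparr>carrier := A\<rparr>) (?f \<sigma> m) S = finprod (G\<lparr>carrier := A\<rparr>) (?f \<sigma>' m') ?S" .
      moreover have "(\<Sum>c\<in>S. m c) = (\<Sum>c\<in>?S. m' c)"
      proof -
        have "(\<Sum>c\<in>S. m c) = m u + (m t + (\<Sum>c\<in>?R. m c))"
          using fin t u False by (simp add: sum.remove[of S u] sum.remove[of ?S t])
        also have "(\<Sum>c\<in>?R. m c) = (\<Sum>c\<in>?R. m' c)" by (intro sum.cong) (auto simp: m'_def)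
        also have "m u + (m t + \<dots>) = (\<Sum>c\<in>?S. m' c)"
          using fin t u False by (simp add: sum.remove[of ?S t] m'_def)
        finally show ?thesis .
      qed
      ultimately show ?thesis using IH by simp
    qed
  qed
qed

section \<open>The lower bound, by mapping to abelian groups\<close>

text \<open>A homomorphism to a commutative group is constant on conjugacy classes, so every factor
  contributes the same value \<open>h x\<close>.\<close>

lemma hom_foldr_conj_class:
  assumes h: "h \<in> hom G H" and H: "comm_group H" and x: "x \<in> carrier G"
    and cs: "set cs \<subseteq> conj_class G x"
  shows "h (foldr (\<lambda>x y. x \<otimes> y) cs \<one>) = h x [^]\<^bsub>H\<^esub> length cs"
proof -
  interpret H: comm_group H by fact
  interpret h: group_hom G H h
    using h by (simp add: group_hom_def group_hom_axioms_def is_group H.is_group)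
  have conj: "h c = h x" if c: "c \<in> conj_class G x" for c
  proof -
    obtain y where y: "y \<in> carrier G" "c = inv y \<otimes> x \<otimes> y"
      using c by (auto simp: conj_class_def)
    then have "h c = inv\<^bsub>H\<^esub> h y \<otimes>\<^bsub>H\<^esub> (h x \<otimes>\<^bsub>H\<^esub> h y)"
      using x by (simp add: H.m_assoc)
    also have "\<dots> = h x"
      using x y H.m_comm[of "h x" "h y"] by (simp add: H.inv_mult_cancel)
    finally show ?thesis .
  qed
  show ?thesis using cs
  proof (induction cs)
    case Nil
    then show ?case by simp
  next
    case (Cons c cs)
    have "c \<in> carrier G" "set cs \<subseteq> carrier G"
      using Cons.prems conj_class_subset_carrier[OF x] by auto
    then show ?case using Cons conj x by (simp add: foldr_mult_closed H.m_comm)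
  qed
qed

lemma pow_eq_one_if_one_in_class_power:
  assumes h: "h \<in> hom G H" and H: "comm_group H" and x: "x \<in> carrier G"
    and "\<one> \<in> class_power G (conj_class G x) k"
  shows "h x [^]\<^bsub>H\<^esub> k = \<one>\<^bsub>H\<^esub>"
proof -
  interpret H: comm_group H by fact
  obtain cs where cs: "length cs = k" "set cs \<subseteq> conj_class G x" "foldr (\<lambda>x y. x \<otimes> y) cs \<one> = \<one>"
    using assms(4) by (auto simp: class_power_def)
  show ?thesis
    using hom_foldr_conj_class[OF h H x cs(2)] cs hom_one[OF h is_group H.is_group] by simp
qed

lemma group_exponent_abelianization_le:
  assumes "k > 0" and "\<And>x. x \<in> carrier G \<Longrightarrow> \<one> \<in> class_power G (conj_class G x) k"
  shows "group_exponent (abelianization G) \<le> k"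
proof -
  let ?H = "abelianization G"
  interpret D: normal "derived G (carrier G)" G by (rule derived_self_is_normal)
  have comm: "comm_group ?H"
    unfolding abelianization_def by (rule derived_quot_is_comm_group)
  have "c [^]\<^bsub>?H\<^esub> k = \<one>\<^bsub>?H\<^esub>" if c: "c \<in> carrier ?H" for c
  proof -
    obtain x where x: "x \<in> carrier G" "c = derived G (carrier G) #> x"
      using c by (auto simp: abelianization_def FactGroup_def RCOSETS_def)
    have "(\<lambda>a. derived G (carrier G) #> a) \<in> hom G ?H"
      unfolding abelianization_def by (rule D.r_coset_hom_Mod)
    from pow_eq_one_if_one_in_class_power[OF this comm x(1) assms(2)[OF x(1)]]
    show ?thesis using x(2) by simp
  qed
  then show ?thesis
    using assms(1) by (auto simp: group_exponent_def intro!: Least_le)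
qed

text \<open>Commutativity of \<open>H\<close> makes \<open>h\<close> kill the derived subgroup. With
  \<open>n\<close> the order of the abelianization, the \<open>n\<close>-th power of
  \<open>x\<close> lies there, so \<open>h x\<close> is torsion and hence trivial. Applied below to
  the transfer.\<close>

lemma hom_trivial_if_finite_abelianization:
  assumes h: "h \<in> hom G H" and H: "comm_group H"
    and torsion_free: "\<And>a n. a \<in> carrier H \<Longrightarrow> (n::nat) > 0 \<Longrightarrow> a [^]\<^bsub>H\<^esub> n = \<one>\<^bsub>H\<^esub> \<Longrightarrow> a = \<one>\<^bsub>H\<^esub>"
    and fin: "finite (carrier (abelianization G))"
    and x: "x \<in> carrier G"
  shows "h x = \<one>\<^bsub>H\<^esub>"
proof -
  let ?D = "derived G (carrier G)"
  interpret H: comm_group H by fact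
  interpret h: group_hom G H h
    using h by (simp add: group_hom_def group_hom_axioms_def is_group H.is_group)
  interpret D: normal ?D G by (rule derived_self_is_normal)
  interpret Q: group "abelianization G"
    unfolding abelianization_def by (rule derived_quot_is_group)
  have "derived_set G (carrier G) \<subseteq> kernel G H h"
    by (auto simp: kernel_def) (simp add: H.m_assoc[symmetric] H.inv_mult_group H.m_comm)
  then have ker: "?D \<subseteq> kernel G H h"
    unfolding derived_def by (intro generate_subgroup_incl h.subgroup_kernel)
  let ?n = "order (abelianization G)"
  interpret p: group_hom G "abelianization G" "\<lambda>a. ?D #> a"
    using D.r_coset_hom_Mod is_group Q.is_group
    by (simp add: group_hom_def group_hom_axioms_def abelianization_def)
  have "?D #> (x [^] ?n) = \<one>\<^bsub>abelianization G\<^esub>"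
    using x Q.pow_order_eq_1[OF p.hom_closed[OF x]] by (simp add: p.hom_nat_pow)
  then have "?D #> (x [^] ?n) = ?D" by (simp add: abelianization_def FactGroup_def)
  then have "x [^] ?n \<in> ?D"
    using rcos_self[of "x [^] ?n" ?D] x D.is_subgroup by auto
  then have "h x [^]\<^bsub>H\<^esub> ?n = \<one>\<^bsub>H\<^esub>"
    using ker x by (auto simp: kernel_def h.hom_nat_pow)
  \<comment> \<open>Finiteness enters here: the \<open>order\<close> of an infinite group is 0 by
    convention, and a vanishing exponent would say nothing about torsion.\<close>
  moreover have "?n > 0"
    using fin Q.one_closed by (auto simp: order_def card_gt_0_iff)
  ultimately show ?thesis using torsion_free x by auto
qed

section \<open>The transfer homomorphism\<close>

lemma bij_betw_rcosets_translate:
  assumes "subgroup A G" "g \<in> carrier G"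
  shows "bij_betw (\<lambda>c. c #> g) (rcosets A) (rcosets A)"
proof (rule bij_betw_byWitness[where f' = "\<lambda>c. c #> inv g"])
  have A: "A \<subseteq> carrier G" using assms(1) by (rule subgroup.subset)
  have "c #> y \<in> rcosets A" if "c \<in> rcosets A" "y \<in> carrier G" for c y
    using that A by (auto simp: RCOSETS_def coset_mult_assoc)
  then show "(\<lambda>c. c #> g) ` (rcosets A) \<subseteq> rcosets A" "(\<lambda>c. c #> inv g) ` (rcosets A) \<subseteq> rcosets A"
    using assms(2) by auto
  have "c \<subseteq> carrier G" if "c \<in> rcosets A" for c
    using that subgroup.rcosets_carrier[OF assms(1) is_group] by auto
  then show "\<forall>c\<in>rcosets A. c #> g #> inv g = c" "\<forall>c\<in>rcosets A. c #> inv g #> g = c"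
    using assms(2) by (auto simp: coset_mult_assoc)
qed

end

text \<open>The product is formed in \<open>A\<close> rather than in \<open>G\<close>: a
  \<open>finprod\<close> over unordered cosets needs commutativity, which \<open>G\<close> may
  lack.\<close>

definition transfer :: "('a, 'b) monoid_scheme \<Rightarrow> 'a set \<Rightarrow> ('a set \<Rightarrow> 'a) \<Rightarrow> 'a \<Rightarrow> 'a" where
  "transfer G A r g = finprod (G\<lparr>carrier := A\<rparr>)
     (\<lambda>c. r c \<otimes>\<^bsub>G\<^esub> g \<otimes>\<^bsub>G\<^esub> inv\<^bsub>G\<^esub> r (c #>\<^bsub>G\<^esub> g)) (rcosets\<^bsub>G\<^esub> A)"

locale abelian_subgroup_section = group G + A: subgroup A G for G (structure) and A +
  fixes r :: "'a set \<Rightarrow> 'a"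
  assumes comm: "comm_group (G\<lparr>carrier := A\<rparr>)"
    and representative: "\<And>c. c \<in> rcosets A \<Longrightarrow> r c \<in> c"
begin

sublocale AG: comm_group "G\<lparr>carrier := A\<rparr>"
  by (rule comm)

lemma representative_closed: "c \<in> rcosets A \<Longrightarrow> r c \<in> carrier G"
  using representative[of c] A.rcosets_carrier[OF is_group, of c] by auto

lemma translate_closed: "c \<in> rcosets A \<Longrightarrow> g \<in> carrier G \<Longrightarrow> c #> g \<in> rcosets A"
  using bij_betw_rcosets_translate[OF A.is_subgroup, of g] by (auto simp: bij_betw_def)

text \<open>Both \<open>r c \<otimes> g\<close> and \<open>r (c #> g)\<close> lie in the right coset
  \<open>c #> g\<close>, so their quotient lies in \<open>A\<close>.\<close>

lemma transfer_factor_closed: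
  assumes c: "c \<in> rcosets A" and g: "g \<in> carrier G"
  shows "r c \<otimes> g \<otimes> inv r (c #> g) \<in> A"
proof -
  have cg: "c #> g \<in> rcosets A" using c g by (rule translate_closed)
  have "r c \<otimes> g \<in> c #> g" using representative[OF c] by (auto simp: r_coset_def)
  moreover have "c #> g = A #> r (c #> g)"
    using representative[OF cg] cg repr_independence[OF _ _ A.is_subgroup]
    unfolding RCOSETS_def by (metis (no_types, lifting) UN_E singletonD)
  ultimately have "r c \<otimes> g \<in> A #> r (c #> g)" by simp
  then show ?thesis
    using A.rcos_module_imp[OF is_group representative_closed[OF cg]] by simp
qed

text \<open>The factors satisfy the cocycle identity
  \<open>?f (g \<otimes> h) c = ?f g c \<otimes> ?f h (c #> g)\<close>. Taking the product over all
  cosets and reindexing the second factor along the permutation \<open>c \<mapsto> c #> g\<close>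
  gives multiplicativity.\<close>

lemma transfer_hom: "transfer G A r \<in> hom G (G\<lparr>carrier := A\<rparr>)"
proof (rule homI)
  let ?f = "\<lambda>g c. r c \<otimes> g \<otimes> inv r (c #> g)"
  have clos: "?f g \<in> rcosets A \<rightarrow> carrier (G\<lparr>carrier := A\<rparr>)" if "g \<in> carrier G" for g
    using that transfer_factor_closed by auto
  show "transfer G A r g \<in> carrier (G\<lparr>carrier := A\<rparr>)" if "g \<in> carrier G" for g
    unfolding transfer_def using clos[OF that] by (rule AG.finprod_closed)
  fix g h assume g: "g \<in> carrier G" and h: "h \<in> carrier G"
  let ?P = "finprod (G\<lparr>carrier := A\<rparr>)"
  have bij: "bij_betw (\<lambda>c. c #> g) (rcosets A) (rcosets A)"
    using A.is_subgroup g by (rule bij_betw_rcosets_translate)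
  have shift: "(\<lambda>c. ?f h (c #> g)) \<in> rcosets A \<rightarrow> carrier (G\<lparr>carrier := A\<rparr>)"
    using clos[OF h] translate_closed[OF _ g] by (auto simp: Pi_iff)
  have "?f (g \<otimes> h) c = ?f g c \<otimes> ?f h (c #> g)" if c: "c \<in> rcosets A" for c
  proof -
    have "c #> (g \<otimes> h) = c #> g #> h"
      using A.rcosets_carrier[OF is_group c] g h by (simp add: coset_mult_assoc)
    then show ?thesis
      using representative_closed[OF c] representative_closed[OF translate_closed[OF c g]]
        representative_closed[OF translate_closed[OF translate_closed[OF c g] h]] g h
      by (simp add: m_assoc inv_mult_cancel)
  qed
  then have "transfer G A r (g \<otimes> h) = ?P (\<lambda>c. ?f g c \<otimes>\<^bsub>G\<lparr>carrier := A\<rparr>\<^esub> ?f h (c #> g)) (rcosets A)"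
    unfolding transfer_def using clos[OF g] shift
    by (intro AG.finprod_cong') (auto simp: Pi_iff)
  also have "\<dots> = ?P (?f g) (rcosets A) \<otimes> ?P (\<lambda>c. ?f h (c #> g)) (rcosets A)"
    using AG.finprod_multf[OF clos[OF g] shift] by simp
  also have "?P (\<lambda>c. ?f h (c #> g)) (rcosets A) = ?P (?f h) (rcosets A)"
    using AG.finprod_reindex[of "?f h" "\<lambda>c. c #> g" "rcosets A"] bij clos[OF h]
    by (simp add: bij_betw_def)
  finally show "transfer G A r (g \<otimes> h) =
      transfer G A r g \<otimes>\<^bsub>G\<lparr>carrier := A\<rparr>\<^esub> transfer G A r h"
    by (simp add: transfer_def)
qed

text \<open>All exponents start at 1, so their sum is the number of cosets.\<close>

lemma transfer_in_class_power:
  assumes "finite (rcosets A)" and g: "g \<in> carrier G"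
  shows "transfer G A r g \<in> class_power G (conj_class G g) (card (rcosets A))"
  using finprod_permutation_in_class_power[OF A.is_subgroup comm g assms(1)
      bij_betw_rcosets_translate[OF A.is_subgroup g], of r "\<lambda>_. 1"]
    representative_closed transfer_factor_closed g
  by (auto simp: transfer_def)

end

section \<open>Free abelian groups, and the conclusion\<close>

lemma free_abelian_imp_comm_group:
  assumes "free_abelian G"
  shows "comm_group G"
  using assms unfolding free_abelian_def
  by (metis abelian_free_Abelian_group comm_group.iso_imp_comm_group group.iso_sym group.is_monoid)

text \<open>Under the isomorphism, powers become integer multiples of formal sums, and a nonzero
  multiple of a formal sum vanishes only if the sum does.\<close>

lemma free_abelian_torsion_free:
  assumes "free_abelian G" and a: "a \<in> carrier G" and n: "(n::nat) > 0" and eq: "a [^]\<^bsub>G\<^esub> n = \<one>\<^bsub>G\<^esub>"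
  shows "a = \<one>\<^bsub>G\<^esub>"
proof -
  obtain S :: "'a set" and h where grp: "group G" and h: "h \<in> iso G (free_Abelian_group S)"
    using assms(1) by (auto simp: free_abelian_def is_iso_def)
  interpret h: group_hom G "free_Abelian_group S" h
    using grp h by (simp add: group_hom_def group_hom_axioms_def iso_def)
  have "frag_cmul (int n) (h a) = 0"
    using h.hom_nat_pow[OF a, of n] eq by (simp del: h.hom_nat_pow)
  then have "h a = 0" using n by (simp add: frag_cmul_eq_0_iff)
  then show ?thesis
    using h a h.hom_one by (auto simp: iso_def bij_betw_def inj_on_def)
qed

theorem theorem1p2:
  fixes G :: "('a, 'b) monoid_scheme" and A :: "'a set"
  assumes "group G"
    and "finitely_generated G"
    and "abelian_by_finite G"
    and "A \<lhd> G"
    and "free_abelian (G\<lparr>carrier := A\<rparr>)"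
    and "finite (carrier (G Mod A))"
    and "finite (carrier (abelianization G))"
  shows "has_gen_exponent G
    \<and> group_exponent (abelianization G) \<le> gen_exponent G
    \<and> gen_exponent G \<le> order (G Mod A)"
proof -
  interpret group G by fact
  interpret A: normal A G by fact
  have ne: "\<exists>x. x \<in> c" if "c \<in> rcosets\<^bsub>G\<^esub> A" for c
    using A.rcosets_non_empty[OF that] by auto
  have comm: "comm_group (G\<lparr>carrier := A\<rparr>)"
    using assms(5) by (rule free_abelian_imp_comm_group)
  \<comment> \<open>The section is Hilbert choice, legitimate because cosets are nonempty.\<close>
  interpret T: abelian_subgroup_section G A "\<lambda>c. SOME x. x \<in> c"
    by (intro abelian_subgroup_section.intro abelian_subgroup_section_axioms.intro
        is_group A.is_subgroup comm) (use ne in \<open>auto intro: someI_ex\<close>)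
  define n where "n = order (G Mod A)"
  have n: "n = card (rcosets\<^bsub>G\<^esub> A)" and fin: "finite (rcosets\<^bsub>G\<^esub> A)"
    using assms(6) by (simp_all add: n_def order_def FactGroup_def)
  have "n > 0"
    using fin A.subgroup_in_rcosets[OF is_group] by (auto simp: n card_gt_0_iff)
  have triv: "transfer G A (\<lambda>c. SOME x. x \<in> c) g = \<one>\<^bsub>G\<^esub>" if "g \<in> carrier G" for g
    using hom_trivial_if_finite_abelianization[OF T.transfer_hom comm _ assms(7) that]
      free_abelian_torsion_free[OF assms(5)] by simp
  let ?P = "\<lambda>k. k > 0 \<and> (\<forall>C\<in>conj_classes G. \<one>\<^bsub>G\<^esub> \<in> class_power G C k)"
  \<comment> \<open>The transfer of each \<open>g\<close> is a product of \<open>n\<close>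
    conjugates of \<open>g\<close> and equals 1; the same \<open>n\<close> serves every
    class.\<close>
  have P: "?P n"
    using T.transfer_in_class_power[OF fin] triv \<open>n > 0\<close> by (auto simp: conj_classes_def n)
  then have has: "has_gen_exponent G" unfolding has_gen_exponent_def by blast
  have eq: "gen_exponent G = (LEAST k. ?P k)" using has by (simp add: gen_exponent_def)
  \<comment> \<open>The least exponent itself satisfies \<open>?P\<close>, so the bound for
    arbitrary such \<open>k\<close> applies to it.\<close>
  have "?P (gen_exponent G)" unfolding eq by (rule LeastI[of ?P, OF P])
  then have "group_exponent (abelianization G) \<le> gen_exponent G"
    by (intro group_exponent_abelianization_le) (auto simp: conj_classes_def)
  moreover have "gen_exponent G \<le> n" unfolding eq by (rule Least_le[of ?P, OF P])
  ultimately show ?thesis using has by (simp add: n_def)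
qed

end
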